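(* Let $G$ be a nontrivial finite group. (1) If $|G|=2$, then $\mathrm{DNG}(G)=*1$. (2) If $|G|$ is odd, then $\mathrm{DNG}(G)=*1$. (3) If the Frattini subgroup $\Phi(G)$ has even order, then $\mathrm{DNG}(G)=*0$. (4) If every maximal subgroup of $G$ has even order, then $\mathrm{DNG}(G)=*0$. (5) If the set of maximal subgroups of $G$ of even order covers $G$, then $\mathrm{DNG}(G)=*0$. (6) Otherwise (that is, if none of the hypotheses of (1)–(5) holds), $\mathrm{DNG}(G)=*3$.
   Context: For a nontrivial finite group $G$, the avoidance game $\mathrm{DNG}(G)$ is the impartial game whose positions are the subsets $P\subseteq G$ with $\langle P\rangle\ne G$; the starting position is $\emptyset$; the options of $P$ are the positions of the form $P\cup\{g\}$ with $g\in G\setminus P$ (and $\langle P\cup\{g\}\rangle\neq G$). Two players alternate moves, and a player who cannot move loses (normal play). The nim-number of a position $P$ is defined recursively by $\mathrm{nim}(P)=\mathrm{mex}\{\mathrm{nim}(Q)\mid Q \text{ an option of } P\}$, where $\mathrm{mex}(A)$ is the least non-negative integer not in $A$. The notation $\mathrm{DNG}(G)=*n$ means that the starting position $\emptyset$ has nim-number $n$. The Frattini subgroup $\Phi(G)$ is the intersection of all maximal subgroups of $G$. A set of subgroups covers $G$ if its union is $G$. *)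

theory Defs
  imports "HOL-Algebra.Generated_Groups"
begin

definition maximal_subgroup :: "'a set \<Rightarrow> ('a, 'b) monoid_scheme \<Rightarrow> bool" where
  "maximal_subgroup M G \<longleftrightarrow>
     subgroup M G \<and> M \<noteq> carrier G \<and>
     (\<forall>H. subgroup H G \<and> M \<subseteq> H \<longrightarrow> H = M \<or> H = carrier G)"

text \<open>Intersecting with the carrier only matters when there are no maximal subgroups,
  which does not happen for a nontrivial finite group.\<close>

definition frattini :: "('a, 'b) monoid_scheme \<Rightarrow> 'a set" where
  "frattini G = carrier G \<inter> \<Inter> {M. maximal_subgroup M G}"

definition mex :: "nat set \<Rightarrow> nat" where
  "mex A = (LEAST n. n \<notin> A)"

definition dng_positions :: "('a, 'b) monoid_scheme \<Rightarrow> 'a set set" where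
  "dng_positions G = {P. P \<subseteq> carrier G \<and> generate G P \<noteq> carrier G}"

definition dng_opts :: "('a, 'b) monoid_scheme \<Rightarrow> 'a set \<Rightarrow> 'a set set" where
  "dng_opts G P = {Q \<in> dng_positions G. \<exists>g \<in> carrier G - P. Q = P \<union> {g}}"

text \<open>The finiteness guard makes the recursion terminate for every record \<open>G\<close>; the value for
  infinite carriers is irrelevant.\<close>

function dng_nim :: "('a, 'b) monoid_scheme \<Rightarrow> 'a set \<Rightarrow> nat" where
  "dng_nim G P =
     (if finite (carrier G) then mex (dng_nim G ` dng_opts G P) else 0)"
  by pat_completeness auto
termination
proof (relation "measure (\<lambda>(G, P). card (carrier G - P))", goal_cases)
  case 1
  show ?case by simp
next
  case (2 G P Q)
  then have "carrier G - Q \<subset> carrier G - P"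
    by (auto simp: dng_opts_def)
  with 2(1) show ?case
    by (simp add: psubset_card_mono)
qed

declare dng_nim.simps [simp del]

text \<open>\<open>DNG G = n\<close> renders the statement that the avoidance game of \<open>G\<close> has value \<open>*n\<close>.\<close>

definition DNG :: "('a, 'b) monoid_scheme \<Rightarrow> nat" where
  "DNG G = dng_nim G {}"

end

theory Submission imports Defs "HOL-Algebra.Sylow" begin

text \<open>
  In a finite group the positions are exactly the subsets of maximal subgroups, so a play ends when
  the chosen set is a maximal subgroup, and the parity of its order decides who moved last. Call a
  set odd-confined if every maximal subgroup above it has odd order, and odd-confinable if it can
  be turned into an odd-confined position by adding one element. These two properties and the
  parity of the cardinality determine the nim-number of a position \<open>P\<close>:

  \<^item> If \<open>P\<close> is odd-confined, all plays from \<open>P\<close> end at an odd cardinality, so only the parity of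
    \<open>P\<close> matters: the value is 1 for even and 0 for odd cardinality.
  \<^item> If \<open>P\<close> is not odd-confined but is odd-confinable, it can move both to a position whose
    terminal positions are all odd and, by adding an involution of a maximal subgroup of even
    order, to one whose terminal positions are all even. Hence \<open>P\<close> sees the values 0 and 1. This
    gives 2 for odd and 3 for even cardinality, where an even \<open>P\<close> sees the value 2 by adding an
    element common to all maximal subgroups above it.
  \<^item> Otherwise the value is the parity of the cardinality of \<open>P\<close>, as it is when every play ends at
    an even cardinality: the threat of odd endings cannot be realised in one move, and the
    opponent can always answer it.

  The induction proving this is \<open>dng_nim_eq_nim_value\<close>. It uses that a maximal subgroup has even
  order if and only if it contains an involution (\<open>even_card_subgroup_iff_involution\<close>), so that a
  single move can rule out all odd endings.

  The theorem is then a matter of evaluating this formula at the empty set. The one point that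
  needs a further argument is that an element \<open>g\<close> outside all maximal subgroups of even order need
  not be a legal first move, because \<open>g\<close> may generate the group. The group is then cyclic, and
  \<open>g\<close> is replaced by \<open>g \<otimes> t\<close>, where \<open>t\<close> is its involution (\<open>odd_confinable_empty\<close>).
\<close>

section \<open>Minimal excluded values\<close>

lemma mex_eqI: "\<lbrakk>n \<notin> A; \<And>k. k < n \<Longrightarrow> k \<in> A\<rbrakk> \<Longrightarrow> mex A = n"
  unfolding mex_def by (rule Least_equality) (auto simp: not_less[symmetric])

lemma dng_nim_eq_mex:
  "finite (carrier G) \<Longrightarrow> dng_nim G P = mex (dng_nim G ` dng_opts G P)"
  by (subst dng_nim.simps) simp

section \<open>Maximal subgroups and involutions\<close>

lemma maximal_subgroupD:
  assumes "maximal_subgroup M G"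
  shows "subgroup M G" "M \<noteq> carrier G" "M \<subseteq> carrier G"
  using assms subgroup.subset unfolding maximal_subgroup_def by auto

lemma (in group) card_subgroup_dvd:
  assumes "subgroup H G" "subgroup K G" "H \<subseteq> K"
  shows "card H dvd card K"
proof -
  interpret K: group "G\<lparr>carrier := K\<rparr>"
    using assms(2) by (rule subgroup_imp_group)
  have "subgroup H (G\<lparr>carrier := K\<rparr>)"
    using assms by (rule subgroup_incl)
  from K.lagrange[OF this] have "card K = card (rcosets\<^bsub>G\<lparr>carrier := K\<rparr>\<^esub> H) * card H"
    by (simp add: order_def)
  then show ?thesis by (rule dvdI[OF trans[OF _ mult.commute]])
qed

text \<open>Cauchy's theorem at the prime 2 together with Lagrange's theorem. This turns the parity of
  the order of a maximal subgroup into the presence of a single element, which a player can add.\<close>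

lemma (in group) even_card_subgroup_iff_involution:
  assumes "finite (carrier G)" and K: "subgroup K G"
  shows "even (card K) \<longleftrightarrow> (\<exists>t\<in>K. t \<noteq> \<one> \<and> t \<otimes> t = \<one>)"
proof
  assume "even (card K)"
  then obtain m where m: "card K = 2 ^ 1 * m" by auto
  interpret K: group "G\<lparr>carrier := K\<rparr>"
    using K by (rule subgroup_imp_group)
  have fin: "finite K"
    using assms subgroup.subset finite_subset by blast
  obtain H where H: "subgroup H (G\<lparr>carrier := K\<rparr>)" "card H = 2"
    using sylow_thm[of 2 "G\<lparr>carrier := K\<rparr>" 1 m] K.group_axioms m fin
    by (auto simp: order_def)
  have HK: "H \<subseteq> K" using subgroup.subset[OF H(1)] by simp
  have HG: "subgroup H G" using incl_subgroup[OF K H(1)] .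
  have one: "\<one> \<in> H" using HG by (rule subgroup.one_closed)
  obtain t where t: "t \<noteq> \<one>" "H = {\<one>, t}"
  proof -
    have "card (H - {\<one>}) = 1" using one H(2) by (simp add: card_Diff_singleton)
    then obtain t where "H - {\<one>} = {t}" by (auto simp: card_1_singleton_iff)
    with one show thesis by (intro that[of t]) auto
  qed
  have tG: "t \<in> carrier G" using subgroup.subset[OF HG] t by auto
  have "t \<otimes> t \<in> H" using subgroup.m_closed[OF HG] t by simp
  with t tG have "t \<otimes> t = \<one>"
    by (metis insertE singletonD Units_eq Units_l_cancel r_one one_closed)
  with t HK show "\<exists>t\<in>K. t \<noteq> \<one> \<and> t \<otimes> t = \<one>" by auto
next
  assume "\<exists>t\<in>K. t \<noteq> \<one> \<and> t \<otimes> t = \<one>"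
  then obtain t where t: "t \<in> K" "t \<noteq> \<one>" "t \<otimes> t = \<one>" by auto
  have tG: "t \<in> carrier G" using subgroup.subset[OF K] t by auto
  have "inv t = t" using t tG by (simp add: inv_equality)
  then have "subgroup {\<one>, t} G"
    using t tG by unfold_locales auto
  then have "card {\<one>, t} dvd card K"
    using K t subgroup.one_closed[OF K] by (intro card_subgroup_dvd) auto
  with t show "even (card K)" by (simp add: numeral_2_eq_2)
qed

lemma (in group) proper_subgroup_in_maximal:
  assumes "finite (carrier G)" "subgroup H G" "H \<noteq> carrier G"
  shows "\<exists>M. maximal_subgroup M G \<and> H \<subseteq> M"
proof -
  let ?A = "{K. subgroup K G \<and> K \<noteq> carrier G}"
  have "?A \<subseteq> Pow (carrier G)" using subgroup.subset by auto
  then have "finite ?A" using assms(1) by (simp add: finite_subset)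
  then obtain M where "M \<in> ?A" "H \<subseteq> M" "\<forall>K\<in>?A. M \<subseteq> K \<longrightarrow> M = K"
    using finite_has_maximal2[of ?A H] assms by auto
  then show ?thesis
    unfolding maximal_subgroup_def by (intro exI[of _ M]) auto
qed

text \<open>From here on the game is played on the family of maximal subgroups: the generated subgroup
  of a set is proper exactly when some maximal subgroup contains the set.\<close>

lemma (in group) dng_positions_iff:
  assumes "finite (carrier G)"
  shows "P \<in> dng_positions G \<longleftrightarrow> (\<exists>M. maximal_subgroup M G \<and> P \<subseteq> M)"
proof
  assume "P \<in> dng_positions G"
  then have P: "P \<subseteq> carrier G" "generate G P \<noteq> carrier G"
    unfolding dng_positions_def by auto
  obtain M where "maximal_subgroup M G" "generate G P \<subseteq> M"
    using proper_subgroup_in_maximal[OF assms generate_is_subgroup[OF P(1)] P(2)] by blast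
  moreover have "P \<subseteq> generate G P" by (auto intro: generate.incl)
  ultimately show "\<exists>M. maximal_subgroup M G \<and> P \<subseteq> M" by blast
next
  assume "\<exists>M. maximal_subgroup M G \<and> P \<subseteq> M"
  then obtain M where M: "maximal_subgroup M G" "P \<subseteq> M" by auto
  note MD = maximal_subgroupD[OF M(1)]
  have "generate G P \<subseteq> M" using generate_subgroup_incl[OF M(2) MD(1)] .
  with M MD show "P \<in> dng_positions G" unfolding dng_positions_def by auto
qed

lemma (in group) dng_opts_iff:
  assumes "finite (carrier G)"
  shows "Q \<in> dng_opts G P \<longleftrightarrow>
    (\<exists>g M. g \<notin> P \<and> Q = insert g P \<and> maximal_subgroup M G \<and> Q \<subseteq> M)"
  unfolding dng_opts_def dng_positions_iff[OF assms]
  by (auto dest: maximal_subgroupD(3))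

section \<open>Nim-values of all positions\<close>

definition odd_confined :: "('a, 'b) monoid_scheme \<Rightarrow> 'a set \<Rightarrow> bool" where
  "odd_confined G P \<longleftrightarrow> (\<forall>M. maximal_subgroup M G \<and> P \<subseteq> M \<longrightarrow> odd (card M))"

definition odd_confinable :: "('a, 'b) monoid_scheme \<Rightarrow> 'a set \<Rightarrow> bool" where
  "odd_confinable G P \<longleftrightarrow>
     (\<exists>g M. maximal_subgroup M G \<and> insert g P \<subseteq> M \<and> odd_confined G (insert g P))"

text \<open>The three branches are the three cases of the introduction; the last one covers both the
  positions with only even endings and those with endings of both parities from which no single
  move rules out the even ones.\<close>

definition nim_value :: "('a, 'b) monoid_scheme \<Rightarrow> 'a set \<Rightarrow> nat" where
  "nim_value G P =
     (if odd_confined G P then (if even (card P) then 1 else 0)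
      else if odd_confinable G P then (if even (card P) then 3 else 2)
      else (if even (card P) then 0 else 1))"

lemma odd_confined_mono: "\<lbrakk>odd_confined G P; P \<subseteq> Q\<rbrakk> \<Longrightarrow> odd_confined G Q"
  unfolding odd_confined_def by blast

text \<open>The intersection of all maximal subgroups above \<open>P\<close> is a subgroup of \<open>N\<close>, hence of odd order,
  and so it cannot equal a set of even cardinality. Adding an element of this intersection flips
  the parity of \<open>P\<close> without changing the maximal subgroups above it.\<close>

lemma (in group) even_position_extends_within_maximals:
  assumes N: "maximal_subgroup N G" "P \<subseteq> N" "odd (card N)" and "even (card P)"
  obtains x where "x \<notin> P" "\<And>M. maximal_subgroup M G \<Longrightarrow> P \<subseteq> M \<Longrightarrow> x \<in> M"
proof -
  let ?I = "\<Inter> {M. maximal_subgroup M G \<and> P \<subseteq> M}"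
  have sub: "subgroup ?I G"
    using N by (intro subgroups_Inter) (auto dest: maximal_subgroupD)
  have "card ?I dvd card N"
    using N by (intro card_subgroup_dvd sub) (auto dest: maximal_subgroupD)
  with N(3) have "odd (card ?I)" by auto
  with \<open>even (card P)\<close> have "?I \<noteq> P" by auto
  moreover have "P \<subseteq> ?I" by auto
  ultimately show thesis using that by blast
qed

lemma (in group) maximal_subgroup_over_involution:
  assumes "finite (carrier G)" "maximal_subgroup M G" "t \<in> M" "t \<noteq> \<one>" "t \<otimes> t = \<one>"
  shows "even (card M)"
  using assms even_card_subgroup_iff_involution maximal_subgroupD(1) by blast

text \<open>Induction on the number of elements not yet chosen: in each of the three cases the options
  miss the claimed value and realise every smaller one.\<close>

theorem (in group) dng_nim_eq_nim_value:
  assumes fin: "finite (carrier G)"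
  shows "maximal_subgroup M G \<Longrightarrow> P \<subseteq> M \<Longrightarrow> dng_nim G P = nim_value G P"
proof (induction "card (carrier G - P)" arbitrary: P M rule: less_induct)
  case less
  have PG: "P \<subseteq> carrier G" using less.prems maximal_subgroupD by blast
  have finP: "finite P" using PG fin finite_subset by blast
  have card_ins: "card (insert g P) = Suc (card P)" if "g \<notin> P" for g
    using that finP by simp
  have IH: "dng_nim G Q = nim_value G Q" if Q: "Q \<in> dng_opts G P" for Q
  proof -
    from Q obtain g M' where g: "g \<notin> P" "Q = insert g P" "maximal_subgroup M' G" "Q \<subseteq> M'"
      unfolding dng_opts_iff[OF fin] by blast
    have "carrier G - Q \<subset> carrier G - P" using g maximal_subgroupD(3) by blast
    then have "card (carrier G - Q) < card (carrier G - P)"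
      using fin by (simp add: psubset_card_mono)
    then show ?thesis using less.hyps g by blast
  qed
  have val: "dng_nim G P = mex (nim_value G ` dng_opts G P)"
    unfolding dng_nim_eq_mex[OF fin, of P] using IH by (simp cong: image_cong)
  have opt: "insert g P \<in> dng_opts G P" if "g \<notin> P" "maximal_subgroup K G" "insert g P \<subseteq> K" for g K
    using that unfolding dng_opts_iff[OF fin] by blast
  have optE: "\<exists>g. g \<notin> P \<and> Q = insert g P" if "Q \<in> dng_opts G P" for Q
    using that unfolding dng_opts_iff[OF fin] by blast
  have card_opt: "card Q = Suc (card P)" if "Q \<in> dng_opts G P" for Q
    using optE[OF that] card_ins by blast
  \<comment> \<open>The move that rules out odd endings: add an involution \<open>t\<close> of \<open>K\<close>. If \<open>t\<close> is already in \<open>P\<close>,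
    any further element of \<open>K\<close> does, and one exists: an involution in \<open>P\<close> excludes
    odd-confinability, so \<open>P\<close> has odd cardinality and cannot be all of \<open>K\<close>.\<close>
  have to_even: "\<exists>Q\<in>dng_opts G P. \<not> odd_confined G Q \<and> \<not> odd_confinable G Q"
    if K: "maximal_subgroup K G" "P \<subseteq> K" "even (card K)"
       and stuck: "odd (card P) \<or> odd_confinable G P" for K
  proof -
    obtain t where t: "t \<in> K" "t \<noteq> \<one>" "t \<otimes> t = \<one>"
      using even_card_subgroup_iff_involution[OF fin maximal_subgroupD(1)[OF K(1)]] K(3) by auto
    have even_over: "even (card M')" if "maximal_subgroup M' G" "t \<in> M'" for M'
      using maximal_subgroup_over_involution[OF fin that(1) _ t(2,3)] that by blast
    have "\<exists>x\<in>K. x \<notin> P \<and> t \<in> insert x P"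
    proof (cases "t \<in> P")
      case False then show ?thesis using t by auto
    next
      case True
      then have "\<not> odd_confinable G P"
        using even_over unfolding odd_confinable_def odd_confined_def by blast
      then have "P \<noteq> K" using stuck K(3) by auto
      then show ?thesis using True K(2) by auto
    qed
    then obtain x where x: "x \<in> K" "x \<notin> P" "t \<in> insert x P" by auto
    have Q: "insert x P \<in> dng_opts G P" using x K by (intro opt) auto
    have "\<not> odd_confined G (insert x P)"
      using x K unfolding odd_confined_def by auto
    moreover have "\<not> odd_confinable G (insert x P)"
      using x even_over unfolding odd_confinable_def odd_confined_def by blast
    ultimately show ?thesis using Q by blast
  qed
  consider (conf) "odd_confined G P"
    | (mixed) "\<not> odd_confined G P" "odd_confinable G P"
    | (even) "\<not> odd_confined G P" "\<not> odd_confinable G P"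
    by blast
  then show ?case
  proof cases
    case conf
    have sub: "odd_confined G Q" if "Q \<in> dng_opts G P" for Q
      using optE[OF that] odd_confined_mono[OF conf] by blast
    show ?thesis
    proof (cases "even (card P)")
      case True
      have "odd (card M)" using conf less.prems unfolding odd_confined_def by blast
      with True have "P \<noteq> M" by auto
      then obtain x where x: "x \<in> M" "x \<notin> P" using less.prems by blast
      have xo: "insert x P \<in> dng_opts G P" using x less.prems by (intro opt) auto
      have "nim_value G Q = 0" if "Q \<in> dng_opts G P" for Q
        using True that by (simp add: nim_value_def card_opt sub)
      then have "nim_value G ` dng_opts G P = {0}" using xo by force
      then have "mex (nim_value G ` dng_opts G P) = 1" by (intro mex_eqI) auto
      then show ?thesis using val conf True by (simp add: nim_value_def)
    next
      case False
      have "nim_value G Q = 1" if "Q \<in> dng_opts G P" for Q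
        using False that by (simp add: nim_value_def card_opt sub)
      then have "mex (nim_value G ` dng_opts G P) = 0" by (intro mex_eqI) auto
      then show ?thesis using val conf False by (simp add: nim_value_def)
    qed
  next
    case mixed
    obtain K where K: "maximal_subgroup K G" "P \<subseteq> K" "even (card K)"
      using mixed unfolding odd_confined_def by blast
    obtain Q0 where Q0: "Q0 \<in> dng_opts G P" "\<not> odd_confined G Q0" "\<not> odd_confinable G Q0"
      using to_even[OF K] mixed by blast
    obtain g N where g: "maximal_subgroup N G" "insert g P \<subseteq> N" "odd_confined G (insert g P)"
      using mixed unfolding odd_confinable_def by blast
    have gP: "g \<notin> P" using g mixed by (metis insert_absorb)
    have Q1: "insert g P \<in> dng_opts G P" using gP g by (intro opt) auto
    have c0: "card Q0 = Suc (card P)" using card_opt[OF Q0(1)] .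
    have c1: "card (insert g P) = Suc (card P)" using card_opt[OF Q1] .
    show ?thesis
    proof (cases "even (card P)")
      case True
      \<comment> \<open>The value 2 comes from an option above which the maximal subgroups are the same as for \<open>P\<close>.\<close>
      have "odd (card N)" using g unfolding odd_confined_def by blast
      then obtain x where x: "x \<notin> P" "\<And>M. maximal_subgroup M G \<Longrightarrow> P \<subseteq> M \<Longrightarrow> x \<in> M"
        using even_position_extends_within_maximals[OF g(1) _ _ True] g(2) by blast
      have xo: "insert x P \<in> dng_opts G P" using x K by (intro opt) auto
      have "\<not> odd_confined G (insert x P)"
        using x K unfolding odd_confined_def by blast
      moreover have "odd_confinable G (insert x P)"
      proof -
        have "insert g (insert x P) \<subseteq> N" using g x by auto
        moreover have "odd_confined G (insert g (insert x P))"
          by (rule odd_confined_mono[OF g(3)]) auto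
        ultimately show ?thesis using g(1) unfolding odd_confinable_def by blast
      qed
      ultimately have "nim_value G (insert x P) = 2"
        using True card_ins[OF x(1)] by (simp add: nim_value_def)
      moreover have "nim_value G Q0 = 1"
        using Q0 True c0 by (simp add: nim_value_def)
      moreover have "nim_value G (insert g P) = 0"
        using g True c1 by (simp add: nim_value_def)
      ultimately have "{0,1,2} \<subseteq> nim_value G ` dng_opts G P"
        using xo Q0(1) Q1 by (simp add: rev_image_eqI)
      moreover have "3 \<notin> nim_value G ` dng_opts G P"
        using True by (auto simp: nim_value_def card_opt split: if_splits)
      moreover have "k \<in> {0,1,2}" if "k < 3" for k :: nat using that by auto
      ultimately have "mex (nim_value G ` dng_opts G P) = 3" by (intro mex_eqI) blast+
      then show ?thesis using val mixed True by (simp add: nim_value_def)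
    next
      case False
      have "nim_value G Q0 = 0" using Q0 False c0 by (simp add: nim_value_def)
      moreover have "nim_value G (insert g P) = 1"
        using g False c1 by (simp add: nim_value_def)
      ultimately have "{0,1} \<subseteq> nim_value G ` dng_opts G P"
        using Q0(1) Q1 by (simp add: rev_image_eqI)
      moreover have "2 \<notin> nim_value G ` dng_opts G P"
        using False by (auto simp: nim_value_def card_opt split: if_splits)
      moreover have "k \<in> {0,1}" if "k < 2" for k :: nat using that by auto
      ultimately have "mex (nim_value G ` dng_opts G P) = 2" by (intro mex_eqI) blast+
      then show ?thesis using val mixed False by (simp add: nim_value_def)
    qed
  next
    case even
    have sub: "\<not> odd_confined G Q" if "Q \<in> dng_opts G P" for Q
      using that even(2) unfolding odd_confinable_def dng_opts_iff[OF fin] by blast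
    show ?thesis
    proof (cases "even (card P)")
      case True
      \<comment> \<open>Only an odd-confined option could have value 0 at odd cardinality.\<close>
      have "0 \<notin> nim_value G ` dng_opts G P"
        using True by (auto simp: nim_value_def card_opt sub split: if_splits)
      then have "mex (nim_value G ` dng_opts G P) = 0" by (intro mex_eqI) auto
      then show ?thesis using val even True by (simp add: nim_value_def)
    next
      case False
      obtain K where K: "maximal_subgroup K G" "P \<subseteq> K" "even (card K)"
        using even unfolding odd_confined_def by blast
      obtain Q0 where Q0: "Q0 \<in> dng_opts G P" "\<not> odd_confined G Q0" "\<not> odd_confinable G Q0"
        using to_even[OF K] False by blast
      have "card Q0 = Suc (card P)" using card_opt[OF Q0(1)] .
      then have "nim_value G Q0 = 0" using Q0 False by (simp add: nim_value_def)
      then have "0 \<in> nim_value G ` dng_opts G P" using Q0 by force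
      moreover have "1 \<notin> nim_value G ` dng_opts G P"
        using False by (auto simp: nim_value_def card_opt sub split: if_splits)
      ultimately have "mex (nim_value G ` dng_opts G P) = 1" by (intro mex_eqI) auto
      then show ?thesis using val even False by (simp add: nim_value_def)
    qed
  qed
qed

section \<open>The starting position\<close>

text \<open>The set is the product of \<open>N\<close> with \<open>{\<one>, t}\<close>, since \<open>t\<close> is its own inverse.\<close>

lemma (in comm_group) subgroup_adjoin_involution:
  assumes N: "subgroup N G" and t: "t \<in> carrier G" "t \<otimes> t = \<one>"
  shows "subgroup {x \<in> carrier G. x \<in> N \<or> x \<otimes> t \<in> N} G" (is "subgroup ?K G")
proof (rule subgroupI)
  have inv_t: "inv t = t" using t by (simp add: inv_equality)
  have NG: "N \<subseteq> carrier G" using N by (rule subgroup.subset)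
  show "?K \<subseteq> carrier G" by auto
  show "?K \<noteq> {}" using subgroup.one_closed[OF N] by auto
  show "inv x \<in> ?K" if "x \<in> ?K" for x
  proof -
    have "inv x \<otimes> t = inv (x \<otimes> t)" using that t inv_t by (simp add: inv_mult)
    with that show ?thesis using subgroup.m_inv_closed[OF N] by auto
  qed
  show "x \<otimes> y \<in> ?K" if "x \<in> ?K" "y \<in> ?K" for x y
  proof -
    have x: "x \<in> carrier G" "x \<in> N \<or> x \<otimes> t \<in> N" and y: "y \<in> carrier G" "y \<in> N \<or> y \<otimes> t \<in> N"
      using that by auto
    have 1: "(x \<otimes> y) \<otimes> t = x \<otimes> (y \<otimes> t)" using x y t by (simp add: m_assoc)
    have 2: "(x \<otimes> y) \<otimes> t = (x \<otimes> t) \<otimes> y" using x y t by (simp add: m_ac)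
    have "(x \<otimes> t) \<otimes> (y \<otimes> t) = (x \<otimes> y) \<otimes> (t \<otimes> t)" using x y t(1) by (simp add: m_ac)
    then have 3: "(x \<otimes> t) \<otimes> (y \<otimes> t) = x \<otimes> y" using x y t by simp
    show ?thesis using x y 1 2 3 subgroup.m_closed[OF N] by (metis (mono_tags, lifting) m_closed mem_Collect_eq)
  qed
qed

lemma (in group) comm_group_if_generated_by_singleton:
  assumes g: "g \<in> carrier G" and gen: "generate G {g} = carrier G"
  shows "comm_group G"
proof (rule group_comm_groupI)
  fix x y assume "x \<in> carrier G" "y \<in> carrier G"
  then obtain k l :: int where "x = g [^] k" "y = g [^] l"
    using generate_pow[OF g] gen by blast
  then show "x \<otimes> y = y \<otimes> x" using g by (simp add: int_pow_mult[symmetric] add.commute)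
qed

text \<open>If \<open>g\<close> does not generate the group, it is itself an odd-confined first move. If it does, the
  group is cyclic, and for an involution \<open>t\<close> maximality gives that \<open>N\<close> and \<open>N t\<close> exhaust the group.
  Consequently \<open>t\<close> is the only involution and \<open>g \<otimes> t\<close> lies in \<open>N\<close>. A maximal subgroup of even order
  containing \<open>g \<otimes> t\<close> would contain \<open>t\<close> as well, hence \<open>g\<close>.\<close>

lemma (in group) odd_confinable_empty:
  assumes fin: "finite (carrier G)"
    and N: "maximal_subgroup N G" "odd (card N)"
    and ev: "even (order G)"
    and g: "g \<in> carrier G" "\<And>M. maximal_subgroup M G \<Longrightarrow> even (card M) \<Longrightarrow> g \<notin> M"
  shows "odd_confinable G {}"
proof (cases "generate G {g} = carrier G")
  case False
  then have "{g} \<in> dng_positions G" using g unfolding dng_positions_def by auto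
  then obtain M where "maximal_subgroup M G" "{g} \<subseteq> M"
    using dng_positions_iff[OF fin] by blast
  moreover have "odd_confined G {g}" using g unfolding odd_confined_def by blast
  ultimately show ?thesis unfolding odd_confinable_def by blast
next
  case True
  interpret comm_group G using comm_group_if_generated_by_singleton g(1) True .
  note ND = maximal_subgroupD[OF N(1)]
  have "even (card (carrier G))" using ev by (simp add: order_def)
  then obtain t where t: "t \<in> carrier G" "t \<noteq> \<one>" "t \<otimes> t = \<one>"
    using even_card_subgroup_iff_involution[OF fin subgroup_self] by blast
  have tN: "t \<notin> N" using maximal_subgroup_over_involution[OF fin N(1)] t N(2) by blast
  let ?K = "{x \<in> carrier G. x \<in> N \<or> x \<otimes> t \<in> N}"
  have "subgroup ?K G" using subgroup_adjoin_involution ND(1) t by blast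
  moreover have "N \<subseteq> ?K" using ND by auto
  moreover have "t \<in> ?K" using t subgroup.one_closed[OF ND(1)] by auto
  ultimately have K: "?K = carrier G"
    using N(1) tN unfolding maximal_subgroup_def by blast
  have gN: "g \<notin> N"
  proof
    assume "g \<in> N"
    then have "generate G {g} \<subseteq> N" using generate_subgroup_incl ND(1) by blast
    with True ND show False by blast
  qed
  then have nN: "g \<otimes> t \<in> N" using K g(1) by blast
  have "odd (card M)" if M: "maximal_subgroup M G" "g \<otimes> t \<in> M" for M
  proof
    assume evM: "even (card M)"
    note MD = maximal_subgroupD[OF M(1)]
    obtain s where s: "s \<in> M" "s \<noteq> \<one>" "s \<otimes> s = \<one>"
      using even_card_subgroup_iff_involution[OF fin MD(1)] evM by blast
    have sG: "s \<in> carrier G" using s MD by auto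
    have "s \<notin> N" using maximal_subgroup_over_involution[OF fin N(1)] s N(2) by blast
    then have stN: "s \<otimes> t \<in> N" using K sG by blast
    \<comment> \<open>Uniqueness of the involution: the product \<open>s \<otimes> t\<close> squares to one within the group \<open>N\<close> of
      odd order.\<close>
    have "(s \<otimes> t) \<otimes> (s \<otimes> t) = (s \<otimes> s) \<otimes> (t \<otimes> t)" using sG t(1) by (simp add: m_ac)
    then have "(s \<otimes> t) \<otimes> (s \<otimes> t) = \<one>" using s t by simp
    then have "s \<otimes> t = \<one>"
      using maximal_subgroup_over_involution[OF fin N(1) stN] N(2) by blast
    then have "s = t" using sG t by (metis right_cancel)
    then have "(g \<otimes> t) \<otimes> t \<in> M" using M(2) s subgroup.m_closed[OF MD(1)] by blast
    then have "g \<in> M" using g(1) t by (simp add: m_assoc)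
    with g(2)[OF M(1) evM] show False by simp
  qed
  then have "odd_confined G {g \<otimes> t}" unfolding odd_confined_def by blast
  then show ?thesis using N(1) nN unfolding odd_confinable_def by blast
qed

text \<open>A subgroup of order 2 is proper because the group does not have order 2, so it extends to a
  maximal subgroup.\<close>

lemma (in group) maximal_subgroup_of_even_order:
  assumes "finite (carrier G)" "even (order G)" "order G \<noteq> 2"
  shows "\<exists>M. maximal_subgroup M G \<and> even (card M)"
proof -
  obtain m where "order G = 2 ^ 1 * m" using assms by auto
  then obtain H where H: "subgroup H G" "card H = 2"
    using sylow_thm[of 2 G 1 m] assms group_axioms by auto
  then have "H \<noteq> carrier G" using assms(3) by (auto simp: order_def)
  then obtain M where M: "maximal_subgroup M G" "H \<subseteq> M"
    using proper_subgroup_in_maximal[OF assms(1) H(1)] by blast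
  have "card H dvd card M" using card_subgroup_dvd H M maximal_subgroupD by blast
  then show ?thesis using H M by auto
qed

theorem corollary6p9:
  fixes G :: "('a, 'b) monoid_scheme"
  assumes "group G" and "finite (carrier G)" and "carrier G \<noteq> {\<one>\<^bsub>G\<^esub>}"
  shows "(order G = 2 \<longrightarrow> DNG G = 1) \<and>
    (odd (order G) \<longrightarrow> DNG G = 1) \<and>
    (even (card (frattini G)) \<longrightarrow> DNG G = 0) \<and>
    ((\<forall>M. maximal_subgroup M G \<longrightarrow> even (card M)) \<longrightarrow> DNG G = 0) \<and>
    (\<Union> {M. maximal_subgroup M G \<and> even (card M)} = carrier G \<longrightarrow> DNG G = 0) \<and>
    (order G \<noteq> 2 \<and>
     \<not> odd (order G) \<and>
     \<not> even (card (frattini G)) \<and>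
     \<not> (\<forall>M. maximal_subgroup M G \<longrightarrow> even (card M)) \<and>
     \<not> \<Union> {M. maximal_subgroup M G \<and> even (card M)} = carrier G
       \<longrightarrow> DNG G = 3)"
proof -
  interpret group G by fact
  note fin = assms(2)
  obtain M0 where M0: "maximal_subgroup M0 G"
    using proper_subgroup_in_maximal[OF fin triv_subgroup] assms(3) by auto
  have DNG: "DNG G = (if odd_confined G {} then 1 else if odd_confinable G {} then 3 else 0)"
    using dng_nim_eq_nim_value[OF fin M0, of "{}"] by (simp add: DNG_def nim_value_def)
  have dvd: "card M dvd order G" if "maximal_subgroup M G" for M
    using card_subgroup_dvd[OF maximal_subgroupD(1)[OF that] subgroup_self] maximal_subgroupD(3)[OF that]
    by (simp add: order_def)
  have all_odd: "DNG G = 1" if "\<And>M. maximal_subgroup M G \<Longrightarrow> odd (card M)"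
    using that DNG by (simp add: odd_confined_def)
  \<comment> \<open>Stated so that it applies both when all maximal subgroups have even order and when those of
    even order cover the group: no first move is odd-confined.\<close>
  have covered: "DNG G = 0"
    if cov: "\<And>g M. maximal_subgroup M G \<Longrightarrow> g \<in> M \<Longrightarrow> \<exists>K. maximal_subgroup K G \<and> even (card K) \<and> g \<in> K"
  proof -
    have "\<not> odd_confinable G {}"
      using cov unfolding odd_confinable_def odd_confined_def by blast
    moreover have "\<not> odd_confined G {}"
      using cov[OF M0 subgroup.one_closed[OF maximal_subgroupD(1)[OF M0]]]
      unfolding odd_confined_def by blast
    ultimately show ?thesis using DNG by simp
  qed
  have 1: "DNG G = 1" if "order G = 2"
  proof (rule all_odd)
    fix M assume M: "maximal_subgroup M G"
    have "M \<subset> carrier G" using maximal_subgroupD[OF M] by auto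
    then have "card M < 2" using psubset_card_mono[OF fin] that by (simp add: order_def)
    moreover have "card M \<noteq> 0" using dvd[OF M] that by (intro notI) simp
    ultimately have "card M = 1" by linarith
    then show "odd (card M)" by simp
  qed
  have 2: "DNG G = 1" if "odd (order G)"
    using that dvd by (intro all_odd) (meson dvd_trans)
  have 4: "DNG G = 0" if "\<forall>M. maximal_subgroup M G \<longrightarrow> even (card M)"
    using that by (intro covered) blast
  have 3: "DNG G = 0" if "even (card (frattini G))"
  proof -
    have F: "frattini G = \<Inter> {M. maximal_subgroup M G}"
      using M0 maximal_subgroupD(3) unfolding frattini_def by blast
    have sub: "subgroup (frattini G) G"
      unfolding F using M0 by (intro subgroups_Inter) (auto dest: maximal_subgroupD)
    have "even (card M)" if M: "maximal_subgroup M G" for M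
    proof -
      have "card (frattini G) dvd card M"
        using card_subgroup_dvd[OF sub maximal_subgroupD(1)[OF M]] M F by blast
      then show ?thesis using \<open>even (card (frattini G))\<close> dvd_trans by blast
    qed
    then show ?thesis using 4 by blast
  qed
  have 5: "DNG G = 0" if "\<Union> {M. maximal_subgroup M G \<and> even (card M)} = carrier G"
    using that maximal_subgroupD(3) by (intro covered) blast
  have 6: "DNG G = 3"
    if ord: "order G \<noteq> 2" "even (order G)"
      and odd_max: "\<not> (\<forall>M. maximal_subgroup M G \<longrightarrow> even (card M))"
      and uncov: "\<Union> {M. maximal_subgroup M G \<and> even (card M)} \<noteq> carrier G"
  proof -
    obtain N where N: "maximal_subgroup N G" "odd (card N)" using odd_max by blast
    obtain g where g: "g \<in> carrier G" "\<And>M. maximal_subgroup M G \<Longrightarrow> even (card M) \<Longrightarrow> g \<notin> M"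
      using uncov maximal_subgroupD(3) by blast
    have "odd_confinable G {}"
      using odd_confinable_empty[OF fin N \<open>even (order G)\<close> g] .
    moreover have "\<not> odd_confined G {}"
      using maximal_subgroup_of_even_order[OF fin ord(2,1)] unfolding odd_confined_def by blast
    ultimately show ?thesis using DNG by simp
  qed
  show ?thesis using 1 2 3 4 5 6 by blast
qed

end
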